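(* Let $A = {}^{1}A\,e_1+{}^{2}A\,e_2 = [\xi_{ij}]_{m\times n}\in\mathbb{C}_2^{m\times n}$ and $B = {}^{1}B\,e_1+{}^{2}B\,e_2=(b_1,\dots,b_m)\in\mathbb{C}_2^m$, and let $AX=B$ be the system of $m$ equations $\sum_{j=1}^n \xi_{ij}x_j=b_i$ ($1\le i\le m$) in $n$ variables $x_1,\dots,x_n\in\mathbb{C}_2$, where $X=(x_1,\dots,x_n)\in\mathbb{C}_2^n$. Then there exists a solution of the system $AX=B$ if and only if $\rho({}^{1}A\mid{}^{1}B)=\rho({}^{1}A)$ and $\rho({}^{2}A\mid{}^{2}B)=\rho({}^{2}A)$.
   Context: $\mathbb{C}_1$ denotes the field of complex numbers (with imaginary unit $i_1$). The bicomplex numbers are the commutative ring $\mathbb{C}_2 = \{z_1 + i_2 z_2 : z_1, z_2\in\mathbb{C}_1\}$ with $i_1^2=i_2^2=-1$, $i_1i_2=i_2i_1$. Put $e_1 = (1+i_1i_2)/2$, $e_2 = (1-i_1i_2)/2$; these are idempotents with $e_1e_2=0$, $e_1+e_2=1$. Every $\xi = z_1+i_2z_2\in\mathbb{C}_2$ is uniquely $\xi = {}^{1}\xi\, e_1 + {}^{2}\xi\, e_2$ with ${}^{1}\xi = z_1 - i_1z_2$, ${}^{2}\xi = z_1+i_1z_2$ in $\mathbb{C}_1$. Applied entrywise, every $A\in\mathbb{C}_2^{m\times n}$ is uniquely ${}^{1}A\,e_1+{}^{2}A\,e_2$ with ${}^{1}A,{}^{2}A\in\mathbb{C}_1^{m\times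 n}$, and every $B\in\mathbb{C}_2^m$ is uniquely ${}^{1}B\,e_1+{}^{2}B\,e_2$ with ${}^{1}B,{}^{2}B\in\mathbb{C}_1^m$. $\rho$ of a complex matrix is its usual rank, and $(M\mid v)$ denotes the matrix $M$ augmented by the column $v$. *)

theory Defs
  imports "HOL-Analysis.Analysis"
begin

text \<open>\<open>Bicomplex z1 z2\<close> stands for \<open>z1 + i2 z2\<close>.\<close>

datatype bicomplex = Bicomplex (bc_z1: complex) (bc_z2: complex)

lemma bicomplex_eq_iff: "x = y \<longleftrightarrow> bc_z1 x = bc_z1 y \<and> bc_z2 x = bc_z2 y"
  by (auto intro: bicomplex.expand)

text \<open>Multiplication is determined by \<open>i2\<^sup>2 = -1\<close> and commutativity.\<close>

instantiation bicomplex :: comm_ring_1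
begin

definition "0 = Bicomplex 0 0"
definition "1 = Bicomplex 1 0"
definition "x + y = Bicomplex (bc_z1 x + bc_z1 y) (bc_z2 x + bc_z2 y)"
definition "x - y = Bicomplex (bc_z1 x - bc_z1 y) (bc_z2 x - bc_z2 y)"
definition "- x = Bicomplex (- bc_z1 x) (- bc_z2 x)"
definition "x * y = Bicomplex (bc_z1 x * bc_z1 y - bc_z2 x * bc_z2 y)
                              (bc_z1 x * bc_z2 y + bc_z2 x * bc_z1 y)"

instance
  by standard
    (simp_all add: zero_bicomplex_def one_bicomplex_def plus_bicomplex_def minus_bicomplex_def
      uminus_bicomplex_def times_bicomplex_def algebra_simps)

end

lemmas bicomplex_arith_defs =
  zero_bicomplex_def one_bicomplex_def plus_bicomplex_def minus_bicomplex_def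
  uminus_bicomplex_def times_bicomplex_def

definition bc_of_complex :: "complex \<Rightarrow> bicomplex"
  where "bc_of_complex z = Bicomplex z 0"

definition bc_i1 :: bicomplex
  where "bc_i1 = bc_of_complex \<i>"

definition bc_i2 :: bicomplex
  where "bc_i2 = Bicomplex 0 1"

definition bc_e1 :: bicomplex
  where "bc_e1 = bc_of_complex (1/2) * (1 + bc_i1 * bc_i2)"

definition bc_e2 :: bicomplex
  where "bc_e2 = bc_of_complex (1/2) * (1 - bc_i1 * bc_i2)"

definition idem1 :: "bicomplex \<Rightarrow> complex"
  where "idem1 \<xi> = bc_z1 \<xi> - \<i> * bc_z2 \<xi>"

definition idem2 :: "bicomplex \<Rightarrow> complex"
  where "idem2 \<xi> = bc_z1 \<xi> + \<i> * bc_z2 \<xi>"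

lemmas bicomplex_defs =
  bicomplex_arith_defs bc_of_complex_def bc_i1_def bc_i2_def bc_e1_def bc_e2_def
  idem1_def idem2_def

lemma bicomplex_cartesian:
  "\<xi> = bc_of_complex (bc_z1 \<xi>) + bc_i2 * bc_of_complex (bc_z2 \<xi>)"
  by (simp add: bicomplex_eq_iff bicomplex_defs)

lemma bicomplex_units:
  "bc_i1 * bc_i1 = - 1" "bc_i2 * bc_i2 = - 1"
  by (simp_all add: bicomplex_defs)

lemma bicomplex_idempotents:
  "bc_e1 * bc_e1 = bc_e1" "bc_e2 * bc_e2 = bc_e2" "bc_e1 * bc_e2 = 0" "bc_e1 + bc_e2 = 1"
  by (simp_all add: bicomplex_defs)

lemma bicomplex_idempotent_decomposition:
  "\<xi> = bc_of_complex z * bc_e1 + bc_of_complex w * bc_e2 \<longleftrightarrow> z = idem1 \<xi> \<and> w = idem2 \<xi>"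
proof
  assume "\<xi> = bc_of_complex z * bc_e1 + bc_of_complex w * bc_e2"
  then show "z = idem1 \<xi> \<and> w = idem2 \<xi>"
    by (simp add: bicomplex_defs field_simps)
next
  assume "z = idem1 \<xi> \<and> w = idem2 \<xi>"
  then show "\<xi> = bc_of_complex z * bc_e1 + bc_of_complex w * bc_e2"
    by (auto simp add: bicomplex_eq_iff bicomplex_defs complex_eq_iff field_simps)
qed

definition map_vector :: "('a \<Rightarrow> 'b) \<Rightarrow> 'a ^ 'n \<Rightarrow> 'b ^ 'n"
  where "map_vector f v = (\<chi> i. f (v $ i))"

text \<open>\<open>(M | v)\<close>: the columns of \<open>M\<close> are indexed by \<open>Inl j\<close>, the additional column \<open>v\<close>
  by \<open>Inr ()\<close>.\<close>

definition augment :: "'a ^ 'n ^ 'm \<Rightarrow> 'a ^ 'm \<Rightarrow> 'a ^ ('n + unit) ^ 'm"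
  where "augment M v = (\<chi> i k. case k of Inl j \<Rightarrow> M $ i $ j | Inr _ \<Rightarrow> v $ i)"

end

theory Submission
  imports Defs
begin

text \<open>The maps \<open>idem1\<close> and \<open>idem2\<close> are ring homomorphisms which together identify the bicomplex
  numbers with the product ring of two copies of the complex numbers. Hence \<open>A X = B\<close> is solvable
  iff both complex component systems are. By the Rouche-Capelli criterion, a linear system over a
  field is solvable iff its right-hand side lies in the column space, i.e. iff appending it as a
  column does not raise the rank.\<close>

text \<open>A basis \<open>S\<close> of the row space expresses the rows as \<open>A $ i = (\<Sum>s\<in>S. c i s *s s)\<close>;
  reading this by columns, the \<open>card S\<close> vectors \<open>\<chi> i. c i s\<close> span the column space.\<close>

lemma dim_columns_le_dim_rows:
  fixes A :: "'a::field ^ 'n ^ 'm"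
  shows "vec.dim (columns A) \<le> vec.dim (rows A)"
proof -
  obtain S where S: "S \<subseteq> rows A" "vec.independent S" "rows A \<subseteq> vec.span S"
      "card S = vec.dim (rows A)"
    using vec.basis_exists by blast
  have fin: "finite S"
    using S(2) by (rule vec.finiteI_independent)
  have "\<exists>c. A $ i = (\<Sum>s\<in>S. c s *s s)" for i
  proof -
    have "row i A \<in> vec.span S"
      using S(3) by (auto simp: rows_def)
    then show ?thesis
      by (auto simp: vec.span_finite[OF fin] row_def)
  qed
  then obtain c where c: "\<And>i. A $ i = (\<Sum>s\<in>S. c i s *s s)"
    by metis
  define T where "T = (\<lambda>s. \<chi> i. c i s) ` S"
  have "column j A \<in> vec.span T" for j
  proof -
    have "column j A = (\<Sum>s\<in>S. (s $ j) *s (\<chi> i. c i s))"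
      by (simp add: vec_eq_iff column_def c mult.commute)
    also have "\<dots> \<in> vec.span T"
      unfolding T_def by (intro vec.span_sum vec.span_scale vec.span_base imageI)
    finally show ?thesis .
  qed
  then have "columns A \<subseteq> vec.span T"
    by (auto simp: columns_def)
  then have "vec.dim (columns A) \<le> card T"
    by (rule vec.dim_le_card) (simp add: T_def fin)
  also have "\<dots> \<le> card S"
    unfolding T_def by (rule card_image_le[OF fin])
  finally show ?thesis
    by (simp add: S(4))
qed

text \<open>\<open>rank\<close> is the dimension of the row space. Transposing swaps rows and
  columns, so the inequality for \<open>A\<close> and for \<open>transpose A\<close> gives both
  directions.\<close>

lemma rank_eq_dim_columns:
  fixes A :: "'a::field ^ 'n ^ 'm"
  shows "rank A = vec.dim (columns A)"
  using dim_columns_le_dim_rows[of A] dim_columns_le_dim_rows[of "transpose A"]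
  by (simp add: row_rank_def_gen rows_transpose columns_transpose)

lemma in_span_columns_iff:
  fixes A :: "'a::field ^ 'n ^ 'm"
  shows "b \<in> vec.span (columns A) \<longleftrightarrow> (\<exists>x. A *v x = b)"
proof
  \<comment> \<open>The range is a subspace, so it contains the span once it contains each column,
    the image of a unit vector.\<close>
  have "columns A \<subseteq> range ((*v) A)"
  proof
    fix v assume "v \<in> columns A"
    then obtain j where "v = column j A"
      by (auto simp: columns_def)
    then have "A *v axis j 1 = v"
      by (simp add: vec_eq_iff matrix_vector_mult_def axis_def column_def if_distrib cong: if_cong)
    then show "v \<in> range ((*v) A)"
      by blast
  qed
  moreover have "vec.subspace (range ((*v) A))"
    by (intro vec.subspace_image vec.subspace_UNIV)
  ultimately have "vec.span (columns A) \<subseteq> range ((*v) A)"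
    by (rule vec.span_minimal)
  then show "\<exists>x. A *v x = b" if "b \<in> vec.span (columns A)"
    using that by blast
qed (auto simp: matrix_vector_mult_in_columnspace_gen)

lemma columns_augment: "columns (augment M v) = insert v (columns M)"
proof -
  have "columns (augment M v) = range (\<lambda>k. column k (augment M v))"
    by (auto simp: columns_def)
  also have "\<dots> = insert v (columns M)"
    by (auto simp: UNIV_sum image_Un image_image column_def augment_def columns_def)
  finally show ?thesis .
qed

text \<open>Inserting \<open>v\<close> into the columns raises the dimension by one exactly when
  \<open>v\<close> lies outside their span.\<close>

lemma rank_augment_eq_iff:
  fixes M :: "'a::field ^ 'n ^ 'm"
  shows "rank (augment M v) = rank M \<longleftrightarrow> (\<exists>x. M *v x = v)"
  by (simp add: rank_eq_dim_columns columns_augment vec.dim_insert flip: in_span_columns_iff)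

lemma idem_mult: "idem1 (x * y) = idem1 x * idem1 y" "idem2 (x * y) = idem2 x * idem2 y"
  by (simp_all add: bicomplex_defs algebra_simps)

lemma idem_sum:
  "idem1 (sum f S) = (\<Sum>x\<in>S. idem1 (f x))" "idem2 (sum f S) = (\<Sum>x\<in>S. idem2 (f x))"
  by (induction S rule: infinite_finite_induct) (simp_all add: bicomplex_defs algebra_simps)

lemma bicomplex_eq_iff_idem: "x = y \<longleftrightarrow> idem1 x = idem1 y \<and> idem2 x = idem2 y"
  by (metis bicomplex_idempotent_decomposition)

text \<open>The witness is the combination of \<open>bc_e1\<close> and \<open>bc_e2\<close> with
  coefficients \<open>z\<close> and \<open>w\<close>.\<close>

lemma idem_surj: "\<exists>\<xi>. idem1 \<xi> = z \<and> idem2 \<xi> = w"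
  by (metis bicomplex_idempotent_decomposition)

lemma map_vector_idem_mult:
  "map_vector idem1 (A *v X) = map_matrix idem1 A *v map_vector idem1 X"
  "map_vector idem2 (A *v X) = map_matrix idem2 A *v map_vector idem2 X"
  by (simp_all add: vec_eq_iff map_vector_def matrix_vector_mult_def idem_sum idem_mult)

lemma map_vector_eq_iff_idem:
  "X = Y \<longleftrightarrow> map_vector idem1 X = map_vector idem1 Y \<and> map_vector idem2 X = map_vector idem2 Y"
  by (auto simp: vec_eq_iff map_vector_def bicomplex_eq_iff_idem)

text \<open>This glues independently chosen solutions of the two complex systems into one bicomplex
  vector.\<close>

lemma map_vector_idem_surj: "\<exists>X. map_vector idem1 X = x \<and> map_vector idem2 X = y"
proof -
  obtain g where "\<And>z w. idem1 (g z w) = z \<and> idem2 (g z w) = w"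
    using idem_surj by metis
  then show ?thesis
    by (intro exI[of _ "\<chi> j. g (x $ j) (y $ j)"]) (simp add: vec_eq_iff map_vector_def)
qed

theorem theorem2p11:
  fixes A :: "bicomplex ^ 'n ^ 'm" and B :: "bicomplex ^ 'm"
  shows "(\<exists>X :: bicomplex ^ 'n. A *v X = B) \<longleftrightarrow>
    rank (augment (map_matrix idem1 A) (map_vector idem1 B)) = rank (map_matrix idem1 A) \<and>
    rank (augment (map_matrix idem2 A) (map_vector idem2 B)) = rank (map_matrix idem2 A)"
  \<comment> \<open>After unfolding, the left side asks for one \<open>X\<close> whose two images
    solve the component systems, the right side for two unrelated solutions.\<close>
  unfolding rank_augment_eq_iff map_vector_eq_iff_idem[of "A *v _"] map_vector_idem_mult
  by (metis map_vector_idem_surj)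

end
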